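(* Let $G$ be a graph with pathwidth at most $p$. Then $\operatorname{pqn}(G)\le p+1$.
   Context: All graphs are finite, simple and undirected; pathwidth is the usual graph parameter (minimum width of a path decomposition). An edge-weighted graph $\langle G,w\rangle$ is a graph $G=(V,E)$ with $w\colon E\to\mathbb{R}$. A PQ-layout of $\langle G,w\rangle$ with $k$ priority queues consists of a linear ordering $\prec$ of $V$ and a partition of $E$ into $k$ sets $\mathcal{P}_1,\dots,\mathcal{P}_k$ such that there is no $i$ and no two edges $e=uv$, $e'=u'v'$ in $\mathcal{P}_i$ with $w(e)>w(e')$ and $u\prec v$, $u'\prec v$, $v\prec v'$. $\operatorname{pqn}(G,w)$ is the minimum $k\ge0$ such that $\langle G,w\rangle$ has a PQ-layout with $k$ priority queues, and $\operatorname{pqn}(G)$ is the minimum $k\ge0$ such that $\operatorname{pqn}(G,w)\le k$ for every $w\colon E\to\mathbb{R}$. *)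

theory Defs
  imports Complex_Main "HOL-Library.Disjoint_Sets"
begin

text \<open>A graph is given by its vertex set and its set of edges, an edge being a
  two-element set of vertices.\<close>

definition fin_simple_graph :: "'a set \<Rightarrow> 'a set set \<Rightarrow> bool" where
  "fin_simple_graph V E \<longleftrightarrow> finite V \<and> (\<forall>e\<in>E. e \<subseteq> V \<and> card e = 2)"

definition path_decomposition :: "'a set \<Rightarrow> 'a set set \<Rightarrow> 'a set list \<Rightarrow> bool" where
  "path_decomposition V E Bs \<longleftrightarrow>
     Bs \<noteq> [] \<and>
     \<Union>(set Bs) = V \<and>
     (\<forall>e\<in>E. \<exists>B\<in>set Bs. e \<subseteq> B) \<and>
     (\<forall>i j k. i \<le> j \<and> j \<le> k \<and> k < length Bs \<longrightarrow> Bs ! i \<inter> Bs ! k \<subseteq> Bs ! j)"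

text \<open>Widths are integers: the graph without vertices has pathwidth \<open>-1\<close>.\<close>

definition pd_width :: "'a set list \<Rightarrow> int" where
  "pd_width Bs = int (Max (card ` set Bs)) - 1"

definition pathwidth :: "'a set \<Rightarrow> 'a set set \<Rightarrow> int" where
  "pathwidth V E = (LEAST t. \<exists>Bs. path_decomposition V E Bs \<and> pd_width Bs = t)"

text \<open>The linear ordering is a strict order relation \<open>r\<close> on \<open>V\<close>. The parts
  \<open>P 0, \<dots>, P (k - 1)\<close> may be empty. A weight function is a function on all
  sets of vertices of which only the values on \<open>E\<close> are used.\<close>

definition pq_layout ::
  "'a set \<Rightarrow> 'a set set \<Rightarrow> ('a set \<Rightarrow> real) \<Rightarrow> nat \<Rightarrow> 'a rel \<Rightarrow> (nat \<Rightarrow> 'a set set) \<Rightarrow> bool" where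
  "pq_layout V E w k r P \<longleftrightarrow>
     r \<subseteq> V \<times> V \<and> strict_linear_order_on V r \<and>
     (\<Union>i<k. P i) = E \<and> disjoint_family_on P {..<k} \<and>
     \<not> (\<exists>i<k. \<exists>u v u' v'. {u, v} \<in> P i \<and> {u', v'} \<in> P i \<and>
           w {u, v} > w {u', v'} \<and> (u, v) \<in> r \<and> (u', v) \<in> r \<and> (v, v') \<in> r)"

definition pqn_weighted :: "'a set \<Rightarrow> 'a set set \<Rightarrow> ('a set \<Rightarrow> real) \<Rightarrow> nat" where
  "pqn_weighted V E w = (LEAST k. \<exists>r P. pq_layout V E w k r P)"

definition pqn :: "'a set \<Rightarrow> 'a set set \<Rightarrow> nat" where
  "pqn V E = (LEAST k. \<forall>w. pqn_weighted V E w \<le> k)"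

lemma path_decomposition_singleton:
  assumes "fin_simple_graph V E"
  shows "path_decomposition V E [V]"
  using assms by (auto simp: path_decomposition_def fin_simple_graph_def)

lemma pathwidth_attained:
  assumes "fin_simple_graph V E"
  shows "\<exists>Bs. path_decomposition V E Bs \<and> pd_width Bs = pathwidth V E"
    and "path_decomposition V E Bs \<Longrightarrow> pathwidth V E \<le> pd_width Bs"
proof -
  let ?Q = "\<lambda>n::nat. \<exists>Bs. path_decomposition V E Bs \<and> pd_width Bs = int n - 1"
  have "?Q (card V)"
    using path_decomposition_singleton[OF assms] by (auto simp: pd_width_def)
  then have ex: "?Q (LEAST n. ?Q n)" by (rule LeastI)
  have le: "int (LEAST n. ?Q n) - 1 \<le> pd_width Cs" if "path_decomposition V E Cs" for Cs
  proof -
    have "?Q (Max (card ` set Cs))" using that by (auto simp: pd_width_def)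
    then have "(LEAST n. ?Q n) \<le> Max (card ` set Cs)" by (rule Least_le)
    then show ?thesis by (simp add: pd_width_def)
  qed
  have eq: "pathwidth V E = int (LEAST n. ?Q n) - 1"
    unfolding pathwidth_def by (rule Least_equality) (use ex le in auto)
  show "\<exists>Bs. path_decomposition V E Bs \<and> pd_width Bs = pathwidth V E"
    using ex eq by simp
  show "path_decomposition V E Bs \<Longrightarrow> pathwidth V E \<le> pd_width Bs"
    using le eq by simp
qed

lemma fin_simple_graph_finite_edges:
  assumes "fin_simple_graph V E"
  shows "finite E"
  by (rule finite_subset[of _ "Pow V"]) (use assms in \<open>auto simp: fin_simple_graph_def\<close>)

lemma pq_layout_card_edges:
  assumes "fin_simple_graph V E"
  shows "\<exists>r P. pq_layout V E w (card E) r P"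
proof -
  have "finite V" using assms by (simp add: fin_simple_graph_def)
  then obtain f :: "'a \<Rightarrow> nat" where f: "inj_on f V"
    using finite_imp_inj_to_nat_seg by blast
  obtain g :: "nat \<Rightarrow> 'a set" where g: "bij_betw g {0..<card E} E"
    using ex_bij_betw_nat_finite[OF fin_simple_graph_finite_edges[OF assms]] by blast
  define r where "r = {(x, y). x \<in> V \<and> y \<in> V \<and> f x < f y}"
  have "pq_layout V E w (card E) r (\<lambda>i. {g i})"
    unfolding pq_layout_def
  proof (intro conjI)
    show "r \<subseteq> V \<times> V" by (auto simp: r_def)
    show "strict_linear_order_on V r"
      using f
      by (auto simp: strict_linear_order_on_def r_def trans_def irrefl_def total_on_def
          inj_on_def) (meson linorder_less_linear)
    show "(\<Union>i<card E. {g i}) = E"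
      using g by (auto simp: bij_betw_def lessThan_atLeast0)
    show "disjoint_family_on (\<lambda>i. {g i}) {..<card E}"
      using g by (auto simp: disjoint_family_on_def bij_betw_def inj_on_def lessThan_atLeast0)
    show "\<not> (\<exists>i<card E. \<exists>u v u' v'. {u, v} \<in> {g i} \<and> {u', v'} \<in> {g i} \<and>
           w {u, v} > w {u', v'} \<and> (u, v) \<in> r \<and> (u', v) \<in> r \<and> (v, v') \<in> r)"
      by auto
  qed
  then show ?thesis by blast
qed

lemma pqn_weighted_attained:
  assumes "fin_simple_graph V E"
  shows "\<exists>r P. pq_layout V E w (pqn_weighted V E w) r P"
  unfolding pqn_weighted_def by (rule LeastI) (rule pq_layout_card_edges[OF assms])

lemma pqn_attained:
  assumes "fin_simple_graph V E"
  shows "pqn_weighted V E w \<le> pqn V E"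
proof -
  have "\<forall>w. pqn_weighted V E w \<le> card E"
    unfolding pqn_weighted_def by (intro allI Least_le pq_layout_card_edges[OF assms])
  then have "\<forall>w. pqn_weighted V E w \<le> pqn V E" unfolding pqn_def by (rule LeastI)
  then show ?thesis ..
qed

end

theory Submission
  imports Defs
begin

text \<open>A path decomposition turns every vertex into an interval of bag indices, and these
  intervals can be coloured with as many colours as the largest bag has vertices, so that each bag
  is rainbow. Order the vertices by the right ends of their intervals and put each edge into the
  queue given by the colour of its larger endpoint. If \<open>u' \<prec> v \<prec> v'\<close> and \<open>u'v'\<close> is an edge, then
  the interval of \<open>v'\<close> meets that of \<open>u'\<close> and ends no earlier than that of \<open>v\<close>, so it contains
  the right end of the interval of \<open>v\<close>. Hence \<open>v\<close> and \<open>v'\<close> have different colours, and no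
  conflict arises, whatever the weights are.\<close>

text \<open>The colours on \<open>B \<inter> U\<close> are distinct, so at least
  \<open>card B - card (B \<inter> U) = card (B - U)\<close> of the \<open>k\<close> colours are
  still free, enough for the remaining elements of \<open>B\<close>. Here \<open>U\<close> stands
  for the vertices coloured already.\<close>

lemma inj_on_extend:
  assumes "finite B" "card B \<le> k" "inj_on c (B \<inter> U)" "c ` (B \<inter> U) \<subseteq> {..<k::nat}"
  shows "\<exists>d. (\<forall>x\<in>U. d x = c x) \<and> inj_on d B \<and> d ` B \<subseteq> {..<k}"
proof -
  have "card (c ` (B \<inter> U)) = card (B \<inter> U)" by (rule card_image) fact
  moreover have "card (B - U) + card (B \<inter> U) = card B"
    using assms(1) card_Diff_subset_Int[of B U] card_mono[of B "B \<inter> U"] by simp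
  moreover have "card ({..<k} - c ` (B \<inter> U)) = k - card (c ` (B \<inter> U))"
    using assms by (subst card_Diff_subset) auto
  ultimately have "card (B - U) \<le> card ({..<k} - c ` (B \<inter> U))" using assms(2) by simp
  then obtain h where h: "h ` (B - U) \<subseteq> {..<k} - c ` (B \<inter> U)" "inj_on h (B - U)"
    using card_le_inj[of "B - U" "{..<k} - c ` (B \<inter> U)"] assms(1) by auto
  define d where "d x = (if x \<in> U then c x else h x)" for x
  have "inj_on d B"
  proof (rule inj_onI)
    fix x y assume "x \<in> B" "y \<in> B" "d x = d y"
    then show "x = y"
      using h assms(3) by (cases "x \<in> U"; cases "y \<in> U") (auto simp: d_def inj_on_def)
  qed
  moreover have "d ` B \<subseteq> {..<k}" using h(1) assms(4) by (auto simp: d_def)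
  moreover have "\<forall>x\<in>U. d x = c x" by (simp add: d_def)
  ultimately show ?thesis by blast
qed

text \<open>Greedy colouring from left to right. By convexity, every vertex of the new bag that has
  occurred before lies in the preceding bag. The colours already present in the new bag are
  therefore distinct, and its new vertices can take free ones.\<close>

lemma rainbow_colouring:
  assumes "\<forall>B\<in>set Bs. finite B \<and> card B \<le> k"
    and "\<forall>i j l. i \<le> j \<and> j \<le> l \<and> l < length Bs \<longrightarrow> Bs ! i \<inter> Bs ! l \<subseteq> Bs ! j"
  shows "\<exists>c. \<forall>B\<in>set Bs. inj_on c B \<and> c ` B \<subseteq> {..<k::nat}"
  using assms
proof (induction Bs rule: rev_induct)
  case Nil
  then show ?case by simp
next
  case (snoc B Bs)
  have conv: "Bs ! i \<inter> Bs ! l \<subseteq> Bs ! j" if "i \<le> j" "j \<le> l" "l < length Bs" for i j l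
    using snoc.prems(2)[rule_format, of i j l] that by (simp add: nth_append)
  have convB: "Bs ! i \<inter> B \<subseteq> Bs ! j" if "i \<le> j" "j < length Bs" for i j
    using snoc.prems(2)[rule_format, of i j "length Bs"] that by (simp add: nth_append)
  obtain c where c: "\<forall>C\<in>set Bs. inj_on c C \<and> c ` C \<subseteq> {..<k}"
    using snoc.IH snoc.prems(1) conv by auto
  define U where "U = \<Union>(set Bs)"
  have "inj_on c (B \<inter> U) \<and> c ` (B \<inter> U) \<subseteq> {..<k}"
  proof (cases "Bs = []")
    case True
    then show ?thesis by (simp add: U_def)
  next
    case False
    have "B \<inter> U \<subseteq> last Bs"
    proof
      fix x assume x: "x \<in> B \<inter> U"
      then obtain i where i: "i < length Bs" "x \<in> Bs ! i"
        by (auto simp: U_def in_set_conv_nth)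
      then have "Bs ! i \<inter> B \<subseteq> Bs ! (length Bs - 1)" by (intro convB) auto
      then have "x \<in> Bs ! (length Bs - 1)" using x i by blast
      then show "x \<in> last Bs" using False by (simp add: last_conv_nth)
    qed
    moreover have "inj_on c (last Bs)" "c ` last Bs \<subseteq> {..<k}" using c False by auto
    ultimately show ?thesis by (auto intro: inj_on_subset)
  qed
  then obtain d where d: "\<forall>x\<in>U. d x = c x" "inj_on d B" "d ` B \<subseteq> {..<k}"
    using inj_on_extend[of B k c U] snoc.prems(1) by auto
  have "inj_on d C \<and> d ` C \<subseteq> {..<k}" if "C \<in> set Bs" for C
  proof -
    have "\<forall>x\<in>C. d x = c x" using d(1) that by (auto simp: U_def)
    then show ?thesis using c that inj_on_cong[of C d c] by auto
  qed
  then show ?case using d by (intro exI[of _ d]) auto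
qed

lemma pq_layout_of_path_decomposition:
  assumes G: "fin_simple_graph V E" and pd: "path_decomposition V E Bs"
    and card: "\<forall>B\<in>set Bs. card B \<le> k"
  shows "\<exists>r P. pq_layout V E w k r P"
proof -
  have V: "finite V" "\<Union>(set Bs) = V" and bag: "\<forall>e\<in>E. \<exists>B\<in>set Bs. e \<subseteq> B"
    and conv: "\<forall>i j l. i \<le> j \<and> j \<le> l \<and> l < length Bs \<longrightarrow> Bs ! i \<inter> Bs ! l \<subseteq> Bs ! j"
    using G pd by (auto simp: fin_simple_graph_def path_decomposition_def)
  have "finite B" if "B \<in> set Bs" for B
    by (rule finite_subset[OF _ V(1)]) (use V(2) that in auto)
  then obtain c where c: "\<forall>B\<in>set Bs. inj_on c B \<and> c ` B \<subseteq> {..<k}"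
    using rainbow_colouring[of Bs k] card conv by auto
  \<comment> \<open>The right end of the interval of \<open>v\<close>; the maximum is meaningful for
    \<open>v \<in> V\<close> because the bags cover \<open>V\<close>.\<close>
  define R where "R v = Max {i. i < length Bs \<and> v \<in> Bs ! i}" for v
  have R_in: "R v < length Bs \<and> v \<in> Bs ! R v" if "v \<in> V" for v
  proof -
    have "{i. i < length Bs \<and> v \<in> Bs ! i} \<noteq> {}"
      using that V(2) by (auto simp: in_set_conv_nth)
    then show ?thesis using Max_in[of "{i. i < length Bs \<and> v \<in> Bs ! i}"] by (simp add: R_def)
  qed
  have R_ge: "i \<le> R v" if "i < length Bs" "v \<in> Bs ! i" for i v
    unfolding R_def by (rule Max_ge) (use that in auto)
  obtain f :: "'a \<Rightarrow> nat" where f: "inj_on f V"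
    using finite_imp_inj_to_nat_seg[OF V(1)] by blast
  \<comment> \<open>Several intervals may end at the same bag; the injection \<open>f\<close> breaks
    such ties.\<close>
  define r where "r = {(x, y). x \<in> V \<and> y \<in> V \<and> (R x < R y \<or> R x = R y \<and> f x < f y)}"
  have rV: "r \<subseteq> V \<times> V" by (auto simp: r_def)
  have r_trans: "(x, z) \<in> r" if "(x, y) \<in> r" "(y, z) \<in> r" for x y z
    using that by (auto simp: r_def)
  have r_asym: "(y, x) \<notin> r" if "(x, y) \<in> r" for x y using that by (auto simp: r_def)
  have r_total: "(x, y) \<in> r \<or> (y, x) \<in> r" if "x \<in> V" "y \<in> V" "x \<noteq> y" for x y
  proof -
    have "f x \<noteq> f y" using f that by (auto simp: inj_on_def)
    then show ?thesis using that by (auto simp: r_def)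
  qed
  define P where "P i = {e \<in> E. \<exists>x y. e = {x, y} \<and> (x, y) \<in> r \<and> c y = i}" for i
  \<comment> \<open>Since \<open>r\<close> is asymmetric, an edge has only one larger endpoint, so
    its queue is determined.\<close>
  have colour: "c y = i" if "{x, y} \<in> P i" "(x, y) \<in> r" for x y i
    using that r_asym unfolding P_def by (auto simp: doubleton_eq_iff)
  have separated: "c v \<noteq> c v'"
    if edge: "{u', v'} \<in> E" and "(u', v) \<in> r" "(v, v') \<in> r" for u' v v'
  proof
    assume eq: "c v = c v'"
    have mem: "v \<in> V" "v' \<in> V" and le: "R u' \<le> R v" "R v \<le> R v'"
      using that(2,3) by (auto simp: r_def)
    obtain B where "B \<in> set Bs" "{u', v'} \<subseteq> B" using bag edge by blast
    then obtain j where j: "j < length Bs" "u' \<in> Bs ! j" "v' \<in> Bs ! j"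
      by (auto simp: in_set_conv_nth)
    \<comment> \<open>Bag \<open>j\<close> contains \<open>u'\<close>, so
      \<open>j \<le> R u' \<le> R v \<le> R v'\<close>. As \<open>v'\<close> lies in the bags
      \<open>j\<close> and \<open>R v'\<close>, convexity puts it into bag \<open>R v\<close>, next
      to \<open>v\<close>.\<close>
    have "j \<le> R v" using R_ge[OF j(1,2)] le(1) by simp
    then have "v' \<in> Bs ! R v"
      using conv[rule_format, of j "R v" "R v'"] le(2) R_in[OF mem(2)] j(3) by blast
    moreover have "inj_on c (Bs ! R v)" "v \<in> Bs ! R v" using c R_in[OF mem(1)] by auto
    ultimately have "v = v'" using eq by (auto dest: inj_onD)
    then show False using that(3) r_asym by blast
  qed
  have "pq_layout V E w k r P"
    unfolding pq_layout_def
  proof (intro conjI)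
    show "strict_linear_order_on V r"
      using r_trans r_asym r_total
      unfolding strict_linear_order_on_def trans_def irrefl_def total_on_def by blast
    show "(\<Union>i<k. P i) = E"
    proof
      show "E \<subseteq> (\<Union>i<k. P i)"
      proof
        fix e assume e: "e \<in> E"
        then obtain a b where ab: "e = {a, b}" "a \<noteq> b" "a \<in> V" "b \<in> V"
          using G by (auto simp: fin_simple_graph_def card_2_iff)
        then have "\<exists>x y. e = {x, y} \<and> (x, y) \<in> r"
          using r_total[of a b] by (auto simp: insert_commute)
        then obtain x y where xy: "e = {x, y}" "(x, y) \<in> r" by blast
        \<comment> \<open>The colour bound is known only inside bags; the last bag of
          \<open>y\<close> supplies one.\<close>
        then have "y \<in> Bs ! R y" "Bs ! R y \<in> set Bs" using R_in[of y] rV by auto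
        then have "c y < k" using c by blast
        then show "e \<in> (\<Union>i<k. P i)" using e xy by (auto simp: P_def)
      qed
    qed (auto simp: P_def)
    have "i = j" if e: "e \<in> P i" "e \<in> P j" for e i j
    proof -
      obtain x y where "e = {x, y}" "(x, y) \<in> r" using e(1) by (auto simp: P_def)
      then show ?thesis using colour e by blast
    qed
    then show "disjoint_family_on P {..<k}" by (auto simp: disjoint_family_on_def)
    have "False" if "{u, v} \<in> P i" "{u', v'} \<in> P i" "(u, v) \<in> r" "(u', v) \<in> r" "(v, v') \<in> r"
      for i u v u' v'
    proof -
      have "{u', v'} \<in> E" using that(2) by (simp add: P_def)
      then have "c v \<noteq> c v'" using separated that by blast
      \<comment> \<open>By transitivity \<open>u'\<close> precedes \<open>v'\<close>, so
        \<open>v\<close> and \<open>v'\<close> are the larger endpoints of the two edges and give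
        both their queues.\<close>
      moreover have "c v = i" "c v' = i" using colour that r_trans by blast+
      ultimately show False by simp
    qed
    then show "\<not> (\<exists>i<k. \<exists>u v u' v'. {u, v} \<in> P i \<and> {u', v'} \<in> P i \<and>
           w {u, v} > w {u', v'} \<and> (u, v) \<in> r \<and> (u', v) \<in> r \<and> (v, v') \<in> r)" by blast
  qed (fact rV)
  then show ?thesis by blast
qed

theorem theorem5p1:
  fixes V :: "'a set" and E :: "'a set set" and p :: int
  assumes "fin_simple_graph V E"
    and "pathwidth V E \<le> p"
  shows "int (pqn V E) \<le> p + 1"
proof -
  obtain Bs where Bs: "path_decomposition V E Bs" "pd_width Bs = pathwidth V E"
    using pathwidth_attained(1)[OF assms(1)] by blast
  \<comment> \<open>The width is the largest bag size minus one, so \<open>k\<close> equals the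
    pathwidth plus one.\<close>
  define k where "k = Max (card ` set Bs)"
  have "\<forall>B\<in>set Bs. card B \<le> k" by (simp add: k_def)
  then have "\<exists>r P. pq_layout V E w k r P" for w
    using pq_layout_of_path_decomposition assms(1) Bs(1) by blast
  then have "\<forall>w. pqn_weighted V E w \<le> k"
    unfolding pqn_weighted_def by (intro allI Least_le)
  then have "pqn V E \<le> k" unfolding pqn_def by (rule Least_le)
  then show ?thesis using Bs(2) assms(2) by (simp add: pd_width_def k_def)
qed

end
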